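(* Let $0<s<1$. The following identities hold as operators on $\mathcal{S}(\mathscr{H})$. (1) For every $m\in\mathscr{M}$, with $T_mg=\sum_{h\in\mathscr{H}}m(h)\langle g,h\rangle h$, $$D^s_m=T_m\circ(-\Delta)^{s/2}_{dy};$$ (2) for every $i\ge0$, with $T_{(i)}g=\sum_{j\in\mathbb{Z}}\langle g,h^j_i\rangle h^j_i$, $$D^s_{(i)}=T_{(i)}\circ(-\Delta)^{s/2}_{dy};$$ (3) with $\mathbf{T}g=\big(\sum_{j\in\mathbb{Z}}\langle g,h^j_i\rangle h^j_i:\ i\ge0\big)$, $$\boldsymbol{\nabla}^s_{dy}=\mathbf{T}\circ(-\Delta)^{s/2}_{dy}.$$
   Context: $\mathbb{R}^+=[0,\infty)$ with Lebesgue measure. Dyadic intervals: for $j\in\mathbb{Z}$ and an integer $k\ge0$, $I^j_k=[k2^{-j},(k+1)2^{-j})$; $\mathcal{D}$ is the family of all of them. For $I=[a,b)$, $2I=[2a,2b)$, so $2I^j_k=I^{j-1}_k$. Haar system: $h^0_0=\mathcal{X}_{[0,1/2)}-\mathcal{X}_{[1/2,1)}$, $h^j_k(x)=2^{j/2}h^0_0(2^jx-k)$, supported in $I^j_k$; $\mathscr{H}=\{h^j_k\}$ is an orthonormal basis of $L^2(\mathbb{R}^+)$; $I(h)$ is the dyadic interval supporting $h$, and $h_I$ is the Haar function supported in $I\in\mathcal{D}$. $\mathcal{S}(\mathscr{H})$ is the linear span (finite linear combinations) of $\mathscr{H}$; $\langle f,h\rangle=\int_{\mathbb{R}^+}fh\,dx$.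 $\mathscr{M}$ is the class of dyadic homogeneous multipliers of degree zero: bounded functions $m:\mathscr{H}\to\mathbb{R}$ such that, writing $m(I):=m(h_I)$, $m(I)=m(2I)$ for every $I\in\mathcal{D}$. For $f\in\mathcal{S}(\mathscr{H})$: the dyadic fractional Laplacian is $(-\Delta)^{s/2}_{dy}f=\sum_{h\in\mathscr{H}}|I(h)|^{-s}\langle f,h\rangle h$; the dyadic directional derivative of order $s$ in the direction $m\in\mathscr{M}$ is $D^s_mf=\sum_{h\in\mathscr{H}}m(h)|I(h)|^{-s}\langle f,h\rangle h$; for $i\ge0$ the $i$-th partial derivative is $D^s_{(i)}=D^s_{m_i}$, where $m_i\in\mathscr{M}$ is given by $m_i(I^j_k)=1$ if $k=i$ and $0$ otherwise, that is, $D^s_{(i)}f=\sum_{j\in\mathbb{Z}}2^{sj}\langle f,h^j_i\rangle h^j_i$; the gradient is $\boldsymbol{\nabla}^s_{dy}f=(D^s_{(i)}f:\ i\ge0)$. *)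

theory Defs
  imports "HOL-Analysis.Analysis"
begin

(* Functions on [0, infinity) are modelled as functions real => real. All Haar functions
   vanish on the negative half-line. *)

definition dyadic_interval :: "int \<Rightarrow> nat \<Rightarrow> real set" where
  "dyadic_interval j k = {real k * 2 powi (-j) ..< (real k + 1) * 2 powi (-j)}"

definition dyadic_intervals :: "real set set" where
  "dyadic_intervals = {dyadic_interval j k |j k. True}"

definition mother_haar :: "real \<Rightarrow> real" where
  "mother_haar x = indicator {0..<1/2} x - indicator {1/2..<1} x"

definition haar :: "int \<Rightarrow> nat \<Rightarrow> real \<Rightarrow> real" where
  "haar j k x = 2 powr (real_of_int j / 2) * mother_haar (2 powi j * x - real k)"

definition haar_system :: "(real \<Rightarrow> real) set" where
  "haar_system = {haar j k |j k. True}"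

(* The next two definitions are I(h), for h in the Haar system, and h_I, for I dyadic. Lemmas
   haar_interval_haar, haar_of_interval_dyadic and haar_nonzero_iff below show that both
   are well defined and that h is nonzero exactly on I(h). *)

definition haar_interval :: "(real \<Rightarrow> real) \<Rightarrow> real set" where
  "haar_interval h = (THE I. \<exists>j k. h = haar j k \<and> I = dyadic_interval j k)"

definition haar_of_interval :: "real set \<Rightarrow> real \<Rightarrow> real" where
  "haar_of_interval I = (THE h. \<exists>j k. I = dyadic_interval j k \<and> h = haar j k)"

definition haar_span :: "(real \<Rightarrow> real) set" where
  "haar_span = {\<lambda>x. \<Sum>h\<in>A. c h * h x |A c. finite A \<and> A \<subseteq> haar_system}"

definition haar_inner :: "(real \<Rightarrow> real) \<Rightarrow> (real \<Rightarrow> real) \<Rightarrow> real" where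
  "haar_inner f h = (LINT x:{0..}|lborel. f x * h x)"

(* A multiplier is a function on the Haar system; its values elsewhere are irrelevant. The
   image of I = [a,b) under x |-> 2 * x is 2I = [2a,2b). *)
definition homogeneous_multipliers :: "((real \<Rightarrow> real) \<Rightarrow> real) set" where
  "homogeneous_multipliers = {m. bounded (m ` haar_system) \<and>
     (\<forall>I\<in>dyadic_intervals. m (haar_of_interval I) = m (haar_of_interval ((\<lambda>x. 2 * x) ` I)))}"

(* In the operators below, the series of functions are summed pointwise; for f in haar_span
   only finitely many of the terms are nonzero. *)

definition frac_laplacian :: "real \<Rightarrow> (real \<Rightarrow> real) \<Rightarrow> real \<Rightarrow> real" where
  "frac_laplacian s f = (\<lambda>x. \<Sum>\<^sub>\<infinity>h\<in>haar_system.
     measure lborel (haar_interval h) powr (-s) * haar_inner f h * h x)"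

definition dyadic_deriv ::
    "real \<Rightarrow> ((real \<Rightarrow> real) \<Rightarrow> real) \<Rightarrow> (real \<Rightarrow> real) \<Rightarrow> real \<Rightarrow> real" where
  "dyadic_deriv s m f = (\<lambda>x. \<Sum>\<^sub>\<infinity>h\<in>haar_system.
     m h * measure lborel (haar_interval h) powr (-s) * haar_inner f h * h x)"

definition coord_multiplier :: "nat \<Rightarrow> (real \<Rightarrow> real) \<Rightarrow> real" where
  "coord_multiplier i h = (if \<exists>j. h = haar j i then 1 else 0)"

definition partial_deriv :: "real \<Rightarrow> nat \<Rightarrow> (real \<Rightarrow> real) \<Rightarrow> real \<Rightarrow> real" where
  "partial_deriv s i = dyadic_deriv s (coord_multiplier i)"

definition dyadic_gradient :: "real \<Rightarrow> (real \<Rightarrow> real) \<Rightarrow> nat \<Rightarrow> real \<Rightarrow> real" where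
  "dyadic_gradient s f = (\<lambda>i. partial_deriv s i f)"

definition haar_multiplier_op ::
    "((real \<Rightarrow> real) \<Rightarrow> real) \<Rightarrow> (real \<Rightarrow> real) \<Rightarrow> real \<Rightarrow> real" where
  "haar_multiplier_op m g = (\<lambda>x. \<Sum>\<^sub>\<infinity>h\<in>haar_system. m h * haar_inner g h * h x)"

definition coord_op :: "nat \<Rightarrow> (real \<Rightarrow> real) \<Rightarrow> real \<Rightarrow> real" where
  "coord_op i g = (\<lambda>x. \<Sum>\<^sub>\<infinity>j\<in>(UNIV :: int set). haar_inner g (haar j i) * haar j i x)"

definition vector_coord_op :: "(real \<Rightarrow> real) \<Rightarrow> nat \<Rightarrow> real \<Rightarrow> real" where
  "vector_coord_op g = (\<lambda>i x. \<Sum>\<^sub>\<infinity>j\<in>(UNIV :: int set). haar_inner g (haar j i) * haar j i x)"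

lemma haar_nonzero_iff: "haar j k x \<noteq> 0 \<longleftrightarrow> x \<in> dyadic_interval j k"
proof -
  have p: "(2::real) powi j > 0" by simp
  have "haar j k x \<noteq> 0 \<longleftrightarrow> real k \<le> 2 powi j * x \<and> 2 powi j * x < real k + 1"
    by (auto simp: haar_def mother_haar_def indicator_def)
  also have "\<dots> \<longleftrightarrow> x \<in> dyadic_interval j k"
    using p by (simp add: dyadic_interval_def power_int_minus field_simps)
  finally show ?thesis .
qed

lemma dyadic_interval_inject:
  "dyadic_interval j k = dyadic_interval j' k' \<longleftrightarrow> j = j' \<and> k = k'"
proof
  assume eq: "dyadic_interval j k = dyadic_interval j' k'"
  have p: "(2::real) powi (-i) > 0" for i by simp
  have lt: "real n * 2 powi (-i) < (real n + 1) * 2 powi (-i)" for i n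
    using p[of i] by simp
  have 1: "real k * 2 powi (-j) = real k' * 2 powi (-j')"
    and 2: "(real k + 1) * 2 powi (-j) = (real k' + 1) * 2 powi (-j')"
    using eq lt[of k j] lt[of k' j'] unfolding dyadic_interval_def
    by (auto simp: Ico_eq_Ico)
  from 1 2 have "(2::real) powi (-j) = 2 powi (-j')" by (simp add: algebra_simps)
  then have "(2::real) powr real_of_int (-j) = 2 powr real_of_int (-j')"
    by (subst (1 2) powr_real_of_int') simp_all
  then have "j = j'" by (subst (asm) powr_inj) auto
  with 1 show "j = j' \<and> k = k'" by simp
qed auto

lemma haar_inject: "haar j k = haar j' k' \<longleftrightarrow> j = j' \<and> k = k'"
proof
  assume "haar j k = haar j' k'"
  then have "dyadic_interval j k = dyadic_interval j' k'"
    by (metis haar_nonzero_iff subsetI subset_antisym)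
  then show "j = j' \<and> k = k'" by (simp add: dyadic_interval_inject)
qed auto

lemma haar_interval_haar: "haar_interval (haar j k) = dyadic_interval j k"
  unfolding haar_interval_def by (rule the_equality) (auto simp: haar_inject)

lemma haar_of_interval_dyadic: "haar_of_interval (dyadic_interval j k) = haar j k"
  unfolding haar_of_interval_def by (rule the_equality) (auto simp: dyadic_interval_inject)

lemma double_dyadic_interval:
  "(\<lambda>x. 2 * x) ` dyadic_interval j k = dyadic_interval (j - 1) k"
proof -
  have e: "(2::real) powi (1 - j) = 2 * 2 powi (-j)"
    using power_int_add[of "2::real" 1 "-j"] by simp
  have "(\<lambda>x::real. 2 * x) ` {a..<b} = {2 * a..<2 * b}" for a b
  proof -
    have "x \<in> (\<lambda>x. 2 * x) ` {a..<b}" if "2 * a \<le> x" "x < 2 * b" for x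
      using that by (intro image_eqI[where x = "x / 2"]) auto
    then show ?thesis by auto
  qed
  then show ?thesis by (simp add: dyadic_interval_def e mult.left_commute)
qed

lemma coord_multiplier_homogeneous: "coord_multiplier i \<in> homogeneous_multipliers"
proof -
  have "coord_multiplier i ` haar_system \<subseteq> {0, 1}" by (auto simp: coord_multiplier_def)
  then have "bounded (coord_multiplier i ` haar_system)"
    by (rule bounded_subset[rotated]) simp
  then show ?thesis
    by (auto simp: homogeneous_multipliers_def dyadic_intervals_def double_dyadic_interval
        haar_of_interval_dyadic coord_multiplier_def haar_inject)
qed

end

theory Submission
  imports Defs
begin

text \<open>
  The Haar system is orthonormal: of two Haar functions of different scale the coarser one is
  constant on the support of the finer one, whose integral vanishes, and two different ones of
  the same scale have disjoint supports. Hence every multiplier operator acts diagonally on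
  finite linear combinations of Haar functions, so the symbols of composed operators multiply.
\<close>

text \<open>The floor form turns nesting and disjointness of dyadic intervals into integer
  arithmetic.\<close>

lemma mem_dyadic_interval_iff: "x \<in> dyadic_interval j k \<longleftrightarrow> \<lfloor>2 powi j * x\<rfloor> = int k"
proof -
  have p: "(2::real) powi j > 0" by simp
  show ?thesis
    using p by (simp add: dyadic_interval_def power_int_minus floor_eq_iff field_simps)
qed

text \<open>Passing from scale \<open>j'\<close> to \<open>j\<close> divides the argument of the
  floor by a power of 2, so the index at the finer scale determines the one at the coarser scale by
  \<open>div\<close>.\<close>

lemma dyadic_interval_coarser:
  assumes "j \<le> j'" "x \<in> dyadic_interval j' k'" "y \<in> dyadic_interval j' k'"
  shows "x \<in> dyadic_interval j k \<longleftrightarrow> y \<in> dyadic_interval j k"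
proof -
  define n where "n = nat (j' - j)"
  have n: "j' = j + int n" using assms(1) by (simp add: n_def)
  have "\<lfloor>2 powi j * z\<rfloor> = \<lfloor>2 powi j' * z\<rfloor> div 2 ^ n" for z :: real
  proof -
    have "2 powi j * z = (2 powi j' * z) / real_of_int (2 ^ n)"
      by (simp add: n power_int_add)
    then show ?thesis by (simp only: floor_divide_real_eq_div zero_le_power zero_le_numeral)
  qed
  then show ?thesis using assms(2,3) by (simp add: mem_dyadic_interval_iff)
qed

lemma dyadic_interval_subset: "dyadic_interval j k \<subseteq> {0..}"
  by (auto simp: dyadic_interval_def intro: order_trans[rotated])

lemma measure_dyadic_interval: "measure lborel (dyadic_interval j k) = 2 powi (-j)"
proof -
  have "real k * 2 powi (-j) \<le> (real k + 1) * 2 powi (-j)" by (intro mult_right_mono) auto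
  then show ?thesis by (simp add: dyadic_interval_def algebra_simps)
qed

lemma dyadic_interval_borel [simp]: "dyadic_interval j k \<in> sets borel"
  by (simp add: dyadic_interval_def)

lemma integrable_indicator_dyadic_interval:
  "integrable lborel (indicator (dyadic_interval j k) :: real \<Rightarrow> real)"
  by (rule integrable_real_indicator) (auto simp: dyadic_interval_def intro!: emeasure_bounded_finite)

text \<open>The two halves of an interval are its children, with indices \<open>2*k\<close> and
  \<open>2*k+1\<close> at scale \<open>j+1\<close>. Integrability, mean zero and constancy on finer
  intervals are all read off from this form.\<close>

lemma haar_eq_halves:
  "haar j k x = 2 powr (j / 2) *
     (indicator (dyadic_interval (j+1) (2*k)) x - indicator (dyadic_interval (j+1) (2*k+1)) x)"
proof -
  have e: "2 powi (j+1) * x = 2 * (2 powi j * x)" by (simp add: power_int_add)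
  show ?thesis
    by (auto simp: haar_def mother_haar_def indicator_def mem_dyadic_interval_iff e floor_eq_iff)
qed

lemma haar_sqr: "haar j k x * haar j k x = 2 powi j * indicator (dyadic_interval j k) x"
proof -
  have p: "(2::real) powr (j / 2) * 2 powr (j / 2) = 2 powi j"
    by (simp add: powr_real_of_int' flip: powr_add)
  have "haar j k x * haar j k x =
    (2 powr (j / 2) * 2 powr (j / 2)) * (if haar j k x \<noteq> 0 then 1 else 0)"
    by (auto simp: haar_def mother_haar_def indicator_def)
  then show ?thesis by (simp only: p haar_nonzero_iff indicator_def of_bool_def)
qed

lemma integrable_haar: "integrable lborel (haar j k)"
  unfolding haar_eq_halves[abs_def]
  by (intro integrable_mult_right Bochner_Integration.integrable_diff
      integrable_indicator_dyadic_interval)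

lemma integral_haar: "integral\<^sup>L lborel (haar j k) = 0"
  unfolding haar_eq_halves[abs_def]
  by (subst integral_mult_right_zero, subst Bochner_Integration.integral_diff)
    (auto simp: measure_dyadic_interval integrable_indicator_dyadic_interval)

text \<open>By the decomposition into halves, the product is built from restrictions of the
  integrable \<open>haar j' k'\<close> to dyadic intervals. This justifies integrating finite sums
  termwise.\<close>

lemma integrable_haar_mult: "integrable lborel (\<lambda>x. haar j k x * haar j' k' x)"
proof -
  have "integrable lborel (\<lambda>x. indicator (dyadic_interval i l) x *\<^sub>R haar j' k' x)" for i l
    by (rule integrable_mult_indicator) (auto intro: integrable_haar)
  then have "integrable lborel (\<lambda>x. 2 powr (j / 2) *
     (indicator (dyadic_interval (j+1) (2*k)) x *\<^sub>R haar j' k' x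
      - indicator (dyadic_interval (j+1) (2*k+1)) x *\<^sub>R haar j' k' x))"
    by (intro integrable_mult_right Bochner_Integration.integrable_diff)
  then show ?thesis
    by (rule back_subst[of "integrable lborel"]) (auto simp: haar_eq_halves[of j] algebra_simps)
qed

lemma haar_inner_haar: "haar_inner f (haar j k) = (\<integral>x. f x * haar j k x \<partial>lborel)"
proof -
  have "indicator {0..} x *\<^sub>R (f x * haar j k x) = f x * haar j k x" for x
    using haar_nonzero_iff[of j k x] dyadic_interval_subset[of j k]
    by (auto simp: indicator_def)
  then show ?thesis by (simp only: haar_inner_def set_lebesgue_integral_def)
qed

lemma integral_haar_mult_finer:
  assumes "j < j'"
  shows "(\<integral>x. haar j k x * haar j' k' x \<partial>lborel) = 0"
proof -
  \<comment> \<open>The left endpoint of the finer interval serves as the sample point at which the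
    constant value of the coarser function is read.\<close>
  define y where "y = (real k') * 2 powi (-j')"
  have y: "y \<in> dyadic_interval j' k'" by (simp add: y_def dyadic_interval_def)
  \<comment> \<open>The halves of the coarser function live at scale \<open>j+1\<close>, and
    \<open>j < j'\<close> gives \<open>j+1 \<le> j'\<close>, so each half contains both points or
    neither.\<close>
  have "haar j k x = haar j k y" if "x \<in> dyadic_interval j' k'" for x
    using dyadic_interval_coarser[OF _ that y, of "j+1"] assms
    by (simp add: haar_eq_halves indicator_def)
  then have "haar j k x * haar j' k' x = haar j k y * haar j' k' x" for x
    using haar_nonzero_iff[of j' k' x] by auto
  then show ?thesis by (simp only: integral_mult_right_zero integral_haar mult_zero_right)
qed

lemma haar_orthonormal:
  assumes "g \<in> haar_system" "h \<in> haar_system"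
  shows "haar_inner g h = (if g = h then 1 else 0)"
proof -
  obtain j k j' k' where g: "g = haar j k" and h: "h = haar j' k'"
    using assms by (auto simp: haar_system_def)
  consider "j < j'" | "j' < j" | "j = j'" "k \<noteq> k'" | "j = j'" "k = k'" by force
  then show ?thesis
  proof cases
    case 1
    then show ?thesis by (simp add: g h haar_inner_haar haar_inject integral_haar_mult_finer)
  next
    case 2
    then show ?thesis using integral_haar_mult_finer[of j' j k' k]
      by (simp add: g h haar_inner_haar haar_inject mult.commute)
  next
    case 3
    \<comment> \<open>At a common scale, a nonzero product would force one floor to equal both
      \<open>k\<close> and \<open>k'\<close>.\<close>
    then have "haar j k x * haar j' k' x = 0" for x
      using haar_nonzero_iff[of j k x] haar_nonzero_iff[of j' k' x]
      by (auto simp: mem_dyadic_interval_iff)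
    then have "haar_inner g h = 0" by (simp only: g h haar_inner_haar integral_zero)
    then show ?thesis using 3 by (simp add: g h haar_inject)
  next
    case 4
    then show ?thesis
      by (simp add: g h haar_inner_haar haar_sqr measure_dyadic_interval flip: power_int_add)
  qed
qed

text \<open>Orthonormality recovers the coefficients. The value 0 outside \<open>A\<close> is what
  later reduces sums over the whole system to sums over \<open>A\<close>.\<close>

lemma haar_inner_sum:
  assumes "finite A" "A \<subseteq> haar_system" "g \<in> haar_system"
  shows "haar_inner (\<lambda>x. \<Sum>h\<in>A. c h * h x) g = (if g \<in> A then c g else 0)"
proof -
  obtain j k where g: "g = haar j k" using assms(3) by (auto simp: haar_system_def)
  have "haar_inner (\<lambda>x. \<Sum>h\<in>A. c h * h x) g = (\<integral>x. (\<Sum>h\<in>A. c h * (h x * g x)) \<partial>lborel)"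
    by (simp add: g haar_inner_haar sum_distrib_right mult.assoc)
  also have "\<dots> = (\<Sum>h\<in>A. \<integral>x. c h * (h x * g x) \<partial>lborel)"
    using assms(2) integrable_haar_mult
    by (intro Bochner_Integration.integral_sum integrable_mult_right) (auto simp: haar_system_def g)
  also have "\<dots> = (\<Sum>h\<in>A. c h * haar_inner h g)"
    by (simp add: g haar_inner_haar)
  also have "\<dots> = (\<Sum>h\<in>A. if h = g then c h else 0)"
    using assms by (intro sum.cong) (auto simp: haar_orthonormal)
  finally show ?thesis using assms(1) by simp
qed

text \<open>All terms outside \<open>A\<close> vanish, so the infinite sum is finite. The result is
  again a combination over the same \<open>A\<close>, so a further operator can be applied in the
  same way.\<close>

lemma haar_multiplier_op_sum:
  assumes "finite A" "A \<subseteq> haar_system"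
  shows "haar_multiplier_op m (\<lambda>x. \<Sum>h\<in>A. c h * h x) = (\<lambda>x. \<Sum>h\<in>A. (m h * c h) * h x)"
proof
  fix x
  have "(\<Sum>\<^sub>\<infinity>h\<in>haar_system. m h * haar_inner (\<lambda>x. \<Sum>h\<in>A. c h * h x) h * h x)
      = (\<Sum>\<^sub>\<infinity>h\<in>A. (m h * c h) * h x)"
    using assms by (intro infsum_cong_neutral) (auto simp: haar_inner_sum)
  then show "haar_multiplier_op m (\<lambda>x. \<Sum>h\<in>A. c h * h x) x = (\<Sum>h\<in>A. (m h * c h) * h x)"
    using assms(1) by (simp add: haar_multiplier_op_def)
qed

lemma haar_multiplier_op_comp:
  assumes "f \<in> haar_span"
  shows "haar_multiplier_op m (haar_multiplier_op l f) = haar_multiplier_op (\<lambda>h. m h * l h) f"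
proof -
  obtain A c where "finite A" "A \<subseteq> haar_system" and f: "f = (\<lambda>x. \<Sum>h\<in>A. c h * h x)"
    using assms by (auto simp: haar_span_def)
  then show ?thesis
    by (simp only: haar_multiplier_op_sum) (simp only: mult.assoc)
qed

lemma frac_laplacian_eq:
  "frac_laplacian s = haar_multiplier_op (\<lambda>h. measure lborel (haar_interval h) powr (-s))"
  by (simp add: fun_eq_iff frac_laplacian_def haar_multiplier_op_def)

lemma dyadic_deriv_eq:
  "dyadic_deriv s m = haar_multiplier_op (\<lambda>h. m h * measure lborel (haar_interval h) powr (-s))"
  by (simp add: fun_eq_iff dyadic_deriv_def haar_multiplier_op_def)

text \<open>The symbol of the derivative is the product of \<open>m\<close> with the symbol of the
  fractional Laplacian, so the composition rule splits it.\<close>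

lemma dyadic_deriv_factor:
  "f \<in> haar_span \<Longrightarrow> dyadic_deriv s m f = haar_multiplier_op m (frac_laplacian s f)"
  by (simp add: frac_laplacian_eq dyadic_deriv_eq haar_multiplier_op_comp)

text \<open>The series over scales is reindexed along the injection from \<open>j\<close> to
  \<open>haar j i\<close>; the multiplier vanishes off its range. Both rewritings of the infinite
  sum hold regardless of convergence, so \<open>g\<close> is arbitrary.\<close>

lemma coord_op_eq: "coord_op i = haar_multiplier_op (coord_multiplier i)"
proof (intro ext)
  fix g x
  have inj: "inj (\<lambda>j. haar j i)" by (auto intro: injI simp: haar_inject)
  have "coord_op i g x = (\<Sum>\<^sub>\<infinity>h\<in>range (\<lambda>j. haar j i). haar_inner g h * h x)"
    by (simp add: coord_op_def infsum_reindex[OF inj] o_def)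
  also have "\<dots> = haar_multiplier_op (coord_multiplier i) g x"
    unfolding haar_multiplier_op_def
    by (intro infsum_cong_neutral) (auto simp: coord_multiplier_def haar_system_def)
  finally show "coord_op i g x = haar_multiplier_op (coord_multiplier i) g x" .
qed

lemma vector_coord_op_eq: "vector_coord_op g = (\<lambda>i. coord_op i g)"
  by (simp add: vector_coord_op_def coord_op_def)

theorem proposition4p2:
  fixes s :: real
  assumes "0 < s" and "s < 1"
  shows "(\<forall>m\<in>homogeneous_multipliers. \<forall>f\<in>haar_span.
            dyadic_deriv s m f = (haar_multiplier_op m \<circ> frac_laplacian s) f) \<and>
         (\<forall>i. \<forall>f\<in>haar_span.
            partial_deriv s i f = (coord_op i \<circ> frac_laplacian s) f) \<and>
         (\<forall>f\<in>haar_span.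
            dyadic_gradient s f = (vector_coord_op \<circ> frac_laplacian s) f)"
  \<comment> \<open>The second identity is the factorization for \<open>coord_multiplier i\<close>;
    the third collects these over all \<open>i\<close>.\<close>
  by (simp add: dyadic_deriv_factor partial_deriv_def dyadic_gradient_def coord_op_eq
      vector_coord_op_eq)

end
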